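(* Let $(X,d)$ be a CAT(0) space and let $A$ and $B$ be two convex, closed, nonempty subsets of $X$. Let $\lambda \in (0,1)$ and let $T:X\to X$ be defined by $Tx:=(1-\lambda)P_Ax + \lambda P_Bx$ for all $x\in X$. Set $r:=d(A,B) = \inf_{(x,y) \in A \times B} d(x,y)$. Let $(x^*,y^* ) \in S_{A,B}$ and $M,b>0$. Set $u^*:=(1-\lambda)x^* + \lambda y^*$. Then, for any $x\in X$ with $d(x,u^* ) \leq M$ and $d^2(P_Ax,P_Bx) \leq b$, we have that for all $\varepsilon > 0$ and all $$n \geq \left\lfloor \frac{64M^2b}{\varepsilon^4\lambda(1-\lambda)} \right\rfloor + 2,$$ $d(P_AT^nx, P_BT^nx) \leq r+ \varepsilon$.
   Context: A geodesic joining $x,y$ in a metric space $(X,d)$ is a map $\gamma:[0,1]\to X$ with $\gamma(0)=x$, $\gamma(1)=y$ and $d(\gamma(t),\gamma(t'))=|t-t'|\,d(x,y)$ for all $t,t'\in[0,1]$; $(X,d)$ is geodesic if any two points are joined by a geodesic. A CAT(0) space is a geodesic space such that for every geodesic $\gamma:[0,1]\to X$, every $z\in X$ and $t\in[0,1]$, $d^2(z,\gamma(t))\le (1-t)d^2(z,\gamma(0))+t\,d^2(z,\gamma(1))-t(1-t)d^2(\gamma(0),\gamma(1))$. Geodesics in a CAT(0) space are unique, and $(1-t)x+ty$ denotes the point $\gamma(t)$ on the unique geodesic $\gamma$ joining $x$ to $y$; a subset is convex if it contains the geodesic between any two of its points. For a nonempty closed convex subset $C$ of $X$, $P_C:X\to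 X$ denotes the metric projection: $P_Cx$ is the unique $z\in C$ with $d(x,z)\le d(x,w)$ for all $w\in C$. It is understood, as part of the notation, that the projections $P_A$ and $P_B$ are defined on all of $X$ (this is automatic when $X$ is complete). $S_{A,B}$ is the set of best approximation pairs, i.e. of all $(x^*,y^* )\in A\times B$ with $d(x^*,y^* )=d(A,B)$. *)

theory Defs
  imports "HOL-Analysis.Analysis"
begin

text \<open>Only the values of \<open>\<gamma>\<close> on \<open>[0,1]\<close> matter; \<open>\<gamma>\<close> is arbitrary elsewhere.\<close>

definition (in metric_space) geodesic_joining :: "(real \<Rightarrow> 'a) \<Rightarrow> 'a \<Rightarrow> 'a \<Rightarrow> bool" where
  "geodesic_joining \<gamma> x y \<longleftrightarrow> \<gamma> 0 = x \<and> \<gamma> 1 = y \<and>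
     (\<forall>t\<in>{0..1}. \<forall>t'\<in>{0..1}. dist (\<gamma> t) (\<gamma> t') = \<bar>t - t'\<bar> * dist x y)"

class geodesic_space = metric_space +
  assumes geodesic_exists: "\<exists>\<gamma>. geodesic_joining \<gamma> x y"

class CAT0_space = geodesic_space +
  assumes CAT0_ineq: "\<lbrakk>geodesic_joining \<gamma> x y; 0 \<le> t; t \<le> 1\<rbrakk> \<Longrightarrow>
    (dist z (\<gamma> t))\<^sup>2 \<le> (1 - t) * (dist z x)\<^sup>2 + t * (dist z y)\<^sup>2 - t * (1 - t) * (dist x y)\<^sup>2"

text \<open>The point \<open>(1 - t) x + t y\<close>, for \<open>t\<close> in \<open>[0,1]\<close>; well defined by \<open>geodesic_point_eq\<close> below.\<close>

definition geodesic_point :: "real \<Rightarrow> 'a::CAT0_space \<Rightarrow> 'a \<Rightarrow> 'a" where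
  "geodesic_point t x y = (THE z. \<exists>\<gamma>. geodesic_joining \<gamma> x y \<and> z = \<gamma> t)"

lemma geodesic_unique:
  fixes x y :: "'a::CAT0_space"
  assumes g: "geodesic_joining \<gamma> x y" and h: "geodesic_joining \<eta> x y"
    and t: "0 \<le> t" "t \<le> 1"
  shows "\<gamma> t = \<eta> t"
proof -
  have hx: "dist (\<eta> t) x = t * dist x y" and hy: "dist (\<eta> t) y = (1 - t) * dist x y"
    using h t unfolding geodesic_joining_def
    by (metis abs_of_nonneg atLeastAtMost_iff diff_zero order_refl zero_le_one)
       (metis abs_minus_commute abs_of_nonneg atLeastAtMost_iff diff_ge_0_iff_ge h
          geodesic_joining_def order_refl t zero_le_one)
  have "(dist (\<eta> t) (\<gamma> t))\<^sup>2 \<le> (1 - t) * (t * dist x y)\<^sup>2 + t * ((1 - t) * dist x y)\<^sup>2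
      - t * (1 - t) * (dist x y)\<^sup>2"
    using CAT0_ineq[OF g t, of "\<eta> t"] by (simp add: hx hy)
  also have "\<dots> = 0"
    by (simp add: power2_eq_square algebra_simps)
  finally show ?thesis
    by simp
qed

lemma geodesic_point_eq:
  fixes x y :: "'a::CAT0_space"
  assumes "geodesic_joining \<gamma> x y" "0 \<le> t" "t \<le> 1"
  shows "geodesic_point t x y = \<gamma> t"
  unfolding geodesic_point_def
  using assms geodesic_unique by (intro the_equality) blast+

definition geodesically_convex :: "'a::metric_space set \<Rightarrow> bool" where
  "geodesically_convex C \<longleftrightarrow>
     (\<forall>x\<in>C. \<forall>y\<in>C. \<forall>\<gamma>. geodesic_joining \<gamma> x y \<longrightarrow> \<gamma> ` {0..1} \<subseteq> C)"

definition nearest_point :: "'a::metric_space set \<Rightarrow> 'a \<Rightarrow> 'a \<Rightarrow> bool" where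
  "nearest_point C x z \<longleftrightarrow> z \<in> C \<and> (\<forall>w\<in>C. dist x z \<le> dist x w)"

text \<open>\<open>metric_proj C x\<close> is meaningful only where the nearest point exists and is unique;
  \<open>metric_proj_defined C\<close> says that this is the case everywhere. For nonempty closed convex
  sets it is automatic in complete CAT(0) spaces, but completeness is not assumed here.\<close>

definition metric_proj_defined :: "'a::metric_space set \<Rightarrow> bool" where
  "metric_proj_defined C \<longleftrightarrow> (\<forall>x. \<exists>!z. nearest_point C x z)"

definition metric_proj :: "'a::metric_space set \<Rightarrow> 'a \<Rightarrow> 'a" where
  "metric_proj C x = (THE z. nearest_point C x z)"

definition best_approx_pairs :: "'a::metric_space set \<Rightarrow> 'a set \<Rightarrow> ('a \<times> 'a) set" where
  "best_approx_pairs A B = {(x, y). x \<in> A \<and> y \<in> B \<and> dist x y = setdist A B}"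

end

theory Submission
  imports Defs
begin

text \<open>
  Write \<open>x\<^sub>k = T\<^sup>k x\<close>, \<open>D\<^sub>k = d(P\<^sub>A x\<^sub>k, P\<^sub>B x\<^sub>k)\<close>, \<open>L = \<lambda>(1 - \<lambda>)\<close>. Since \<open>x\<^sub>k\<^sub>+\<^sub>1\<close> lies on the geodesic
  from \<open>P\<^sub>A x\<^sub>k\<close> to \<open>P\<^sub>B x\<^sub>k\<close>, the distances from \<open>x\<^sub>k\<^sub>+\<^sub>1\<close> to \<open>A\<close> and \<open>B\<close> are at most \<open>\<lambda>D\<^sub>k\<close>
  and \<open>(1 - \<lambda>)D\<^sub>k\<close>. Hence \<open>D\<^sub>k\<close> is nonincreasing, and it suffices to show that \<open>D\<^sub>1, \<dots>, D\<^sub>n\<close>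
  cannot all exceed \<open>r + \<epsilon>\<close>.

  One step of \<open>T\<close> is a gradient step for the convex function
  \<open>f(z) = (1 - \<lambda>) d\<^sup>2(z,A) + \<lambda> d\<^sup>2(z,B)\<close>, whose minimum is attained at \<open>u\<^sup>*\<close>. In a Hilbert space, the
  gradient inequality bounds \<open>f(z) - f(u\<^sup>*)\<close> by \<open>2\<langle>z - Tz, z - u\<^sup>*\<rangle>\<close>. In a CAT(0) space there is
  no inner product, but \<open>\<langle>a - d, b - c\<rangle>\<close> can be replaced by an expression in the squared sides
  and diagonals of a quadrilateral, and the Cauchy-Schwarz inequality survives in this form
  (\<open>CAT0_quadrilateral\<close>). Together with the obtuse angle that a projection makes
  (\<open>nearest_point_pythagoras\<close>) and the CAT(0) inequality at \<open>u\<^sup>*\<close>, this yields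
  (\<open>averaged_projection_step\<close>, \<open>averaged_projection_energy\<close>)
  \<open>d\<^sup>2(x\<^sub>k\<^sub>+\<^sub>2,u\<^sup>*) + L D\<^sub>k\<^sub>+\<^sub>1\<^sup>2 + 2L D\<^sub>k\<^sub>+\<^sub>1(D\<^sub>k\<^sub>+\<^sub>1 - r) \<le> d\<^sup>2(x\<^sub>k\<^sub>+\<^sub>1,u\<^sup>*) + L D\<^sub>k\<^sup>2\<close>.
  Telescoping gives \<open>2L \<Sum>\<^sub>1\<^sub>\<le>\<^sub>k\<^sub>\<le>\<^sub>n D\<^sub>k(D\<^sub>k - r) \<le> M\<^sup>2 + L b\<close>. If \<open>D\<^sub>n > r + \<epsilon>\<close>, every summand
  exceeds \<open>\<epsilon>\<^sup>2\<close>, so \<open>2nL\<epsilon>\<^sup>2 \<le> M\<^sup>2 + L b\<close>. This sum of two terms is compared with the product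
  \<open>M\<^sup>2 b\<close> through \<open>\<epsilon>\<^sup>2 < D\<^sub>0\<^sup>2 \<le> b\<close> and \<open>\<epsilon> < D\<^sub>0 - r \<le> 2M\<close>, the latter because projections are
  nonexpansive. The outcome is \<open>n \<le> M\<^sup>2 b / (\<epsilon>\<^sup>4 L)\<close>, which contradicts the choice of \<open>n\<close>.
\<close>

section \<open>Geometry of CAT(0) spaces\<close>

lemma geodesic_point_dist:
  fixes x y :: "'a::CAT0_space"
  assumes t: "0 \<le> t" "t \<le> 1"
  shows "dist (geodesic_point t x y) x = t * dist x y"
    and "dist (geodesic_point t x y) y = (1 - t) * dist x y"
proof -
  obtain \<gamma> where g: "geodesic_joining \<gamma> x y"
    using geodesic_exists by blast
  then have ends: "\<gamma> 0 = x" "\<gamma> 1 = y"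
    and "\<forall>s\<in>{0..1}. \<forall>s'\<in>{0..1}. dist (\<gamma> s) (\<gamma> s') = \<bar>s - s'\<bar> * dist x y"
    unfolding geodesic_joining_def by blast+
  then have "dist (\<gamma> t) (\<gamma> 0) = \<bar>t - 0\<bar> * dist x y" "dist (\<gamma> t) (\<gamma> 1) = \<bar>t - 1\<bar> * dist x y"
    by (meson atLeastAtMost_iff order_refl t zero_le_one)+
  then show "dist (geodesic_point t x y) x = t * dist x y"
    and "dist (geodesic_point t x y) y = (1 - t) * dist x y"
    using t by (simp_all add: ends geodesic_point_eq[OF g t])
qed

lemma geodesic_point_CAT0:
  fixes x y z :: "'a::CAT0_space"
  assumes t: "0 \<le> t" "t \<le> 1"
  shows "(dist z (geodesic_point t x y))\<^sup>2
    \<le> (1 - t) * (dist z x)\<^sup>2 + t * (dist z y)\<^sup>2 - t * (1 - t) * (dist x y)\<^sup>2"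
proof -
  obtain \<gamma> where g: "geodesic_joining \<gamma> x y"
    using geodesic_exists by blast
  show ?thesis
    using CAT0_ineq[OF g t] by (simp add: geodesic_point_eq[OF g t])
qed

lemma geodesic_point_in_convex:
  fixes x y :: "'a::CAT0_space"
  assumes "geodesically_convex C" "x \<in> C" "y \<in> C" and t: "0 \<le> t" "t \<le> 1"
  shows "geodesic_point t x y \<in> C"
proof -
  obtain \<gamma> where g: "geodesic_joining \<gamma> x y"
    using geodesic_exists by blast
  then have "\<gamma> ` {0..1} \<subseteq> C"
    using assms(1-3) by (simp add: geodesically_convex_def)
  then show ?thesis
    using t by (auto simp: geodesic_point_eq[OF g t])
qed

lemma weighted_square_sum_ge:
  fixes t p q :: real
  shows "t * (1 - t) * (p + q)\<^sup>2 \<le> t * p\<^sup>2 + (1 - t) * q\<^sup>2"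
proof -
  have "t * p\<^sup>2 + (1 - t) * q\<^sup>2 - t * (1 - t) * (p + q)\<^sup>2 = (t * p - (1 - t) * q)\<^sup>2"
    by algebra
  also have "\<dots> \<ge> 0"
    by simp
  finally show ?thesis
    by simp
qed

text \<open>
  The Cauchy-Schwarz inequality for the quasi-inner product of Berg and Nikolaev: in a Hilbert
  space the difference of the two sums of squares is \<open>2\<langle>a - d, b - c\<rangle>\<close>. It holds because the diagonal
  from \<open>a\<close> to \<open>c\<close> is no longer than the detour through any point of the other diagonal, whose
  distances to \<open>a\<close> and \<open>c\<close> the CAT(0) inequality controls; optimising over the point on the
  diagonal produces the product term.
\<close>
lemma CAT0_quadrilateral:
  fixes a b c d :: "'a::CAT0_space"
  shows "(dist a c)\<^sup>2 + (dist b d)\<^sup>2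
    \<le> (dist a b)\<^sup>2 + (dist c d)\<^sup>2 + 2 * dist a d * dist b c"
proof (cases "a = d \<or> b = c")
  case True
  then show ?thesis
    by (auto simp: dist_commute)
next
  case False
  define p q where "p = dist a d" and "q = dist b c"
  have pq: "p > 0" "q > 0"
    using False by (auto simp: p_def q_def)
  \<comment> \<open>This \<open>t\<close> minimises \<open>t / (1 - t) * p\<^sup>2 + (1 - t) / t * q\<^sup>2\<close>, with minimal value \<open>2 p q\<close>.\<close>
  define t where "t = q / (p + q)"
  have t1: "1 - t = p / (p + q)" and t: "0 < t" "t < 1"
    using pq by (auto simp: t_def field_simps)
  have opt: "t\<^sup>2 * p\<^sup>2 + (1 - t)\<^sup>2 * q\<^sup>2 = t * (1 - t) * (2 * p * q)"
    unfolding t1 unfolding t_def using pq by (simp add: field_simps power2_eq_square)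
  define e where "e = geodesic_point t b d"
  have "t * (1 - t) * (dist a c)\<^sup>2 \<le> t * (1 - t) * (dist a e + dist c e)\<^sup>2"
    using t dist_triangle[of a c e] by (intro mult_left_mono power_mono) (auto simp: dist_commute)
  also have "\<dots> \<le> t * (dist a e)\<^sup>2 + (1 - t) * (dist c e)\<^sup>2"
    by (rule weighted_square_sum_ge)
  also have "\<dots> \<le> t * ((1 - t) * (dist a b)\<^sup>2 + t * p\<^sup>2 - t * (1 - t) * (dist b d)\<^sup>2)
      + (1 - t) * ((1 - t) * q\<^sup>2 + t * (dist c d)\<^sup>2 - t * (1 - t) * (dist b d)\<^sup>2)"
    using t geodesic_point_CAT0[of t a b d] geodesic_point_CAT0[of t c b d]
    by (intro add_mono mult_left_mono) (auto simp: e_def p_def q_def dist_commute)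
  also have "\<dots> = t * (1 - t) * ((dist a b)\<^sup>2 + (dist c d)\<^sup>2 - (dist b d)\<^sup>2)
      + (t\<^sup>2 * p\<^sup>2 + (1 - t)\<^sup>2 * q\<^sup>2)"
    by (simp add: power2_eq_square algebra_simps)
  also have "\<dots> = t * (1 - t) * ((dist a b)\<^sup>2 + (dist c d)\<^sup>2 - (dist b d)\<^sup>2 + 2 * p * q)"
    unfolding opt by (simp add: algebra_simps)
  finally have "(dist a c)\<^sup>2 \<le> (dist a b)\<^sup>2 + (dist c d)\<^sup>2 - (dist b d)\<^sup>2 + 2 * p * q"
    using t by simp
  then show ?thesis
    by (simp add: p_def q_def)
qed

section \<open>Nearest points in convex sets\<close>

text \<open>
  The angle at the nearest point \<open>p\<close> is obtuse: a step from \<open>p\<close> of relative length \<open>t\<close> towards \<open>w\<close>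
  stays in \<open>C\<close> and so does not approach \<open>z\<close>; the bound is the limit \<open>t \<rightarrow> 0\<close> of the CAT(0)
  inequality.
\<close>
lemma nearest_point_pythagoras:
  fixes z :: "'a::CAT0_space"
  assumes C: "geodesically_convex C" and p: "nearest_point C z p" and w: "w \<in> C"
  shows "(dist z p)\<^sup>2 + (dist p w)\<^sup>2 \<le> (dist z w)\<^sup>2"
proof -
  have step: "(dist z p)\<^sup>2 + (1 - t) * (dist p w)\<^sup>2 \<le> (dist z w)\<^sup>2" if t: "0 < t" "t < 1" for t
  proof -
    have "geodesic_point t p w \<in> C"
      using C p w t by (intro geodesic_point_in_convex) (auto simp: nearest_point_def)
    then have "(dist z p)\<^sup>2 \<le> (dist z (geodesic_point t p w))\<^sup>2"
      using p by (intro power_mono) (auto simp: nearest_point_def)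
    also have "\<dots> \<le> (1 - t) * (dist z p)\<^sup>2 + t * (dist z w)\<^sup>2 - t * (1 - t) * (dist p w)\<^sup>2"
      using t by (intro geodesic_point_CAT0) auto
    finally have "t * ((dist z p)\<^sup>2 + (1 - t) * (dist p w)\<^sup>2) \<le> t * (dist z w)\<^sup>2"
      by (simp add: algebra_simps)
    then show ?thesis
      using t by simp
  qed
  have "((\<lambda>t. (dist z p)\<^sup>2 + (1 - t) * (dist p w)\<^sup>2)
      \<longlongrightarrow> (dist z p)\<^sup>2 + (1 - 0) * (dist p w)\<^sup>2) (at_right 0)"
    by (intro tendsto_intros)
  moreover have "\<forall>\<^sub>F t::real in at_right 0.
      (dist z p)\<^sup>2 + (1 - t) * (dist p w)\<^sup>2 \<le> (dist z w)\<^sup>2"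
    unfolding eventually_at_right_field using step zero_less_one by blast
  ultimately have "(dist z p)\<^sup>2 + (1 - 0) * (dist p w)\<^sup>2 \<le> (dist z w)\<^sup>2"
    by (rule tendsto_upperbound) simp
  then show ?thesis
    by simp
qed

lemma nearest_point_nonexpansive:
  fixes z u :: "'a::CAT0_space"
  assumes C: "geodesically_convex C" and p: "nearest_point C z p" and q: "nearest_point C u q"
  shows "dist p q \<le> dist z u"
proof (cases "p = q")
  case False
  have "(dist z p)\<^sup>2 + (dist p q)\<^sup>2 \<le> (dist z q)\<^sup>2" "(dist u q)\<^sup>2 + (dist q p)\<^sup>2 \<le> (dist u p)\<^sup>2"
    using nearest_point_pythagoras[OF C p] nearest_point_pythagoras[OF C q] p q
    by (auto simp: nearest_point_def)
  then have "dist p q * dist p q \<le> dist z u * dist p q"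
    using CAT0_quadrilateral[of z q p u] by (simp add: power2_eq_square dist_commute)
  then show ?thesis
    using False by simp
qed simp

text \<open>
  The gradient inequality for the squared distance to \<open>C\<close>: in a Hilbert space it reads
  \<open>\<langle>z - p, z - u\<rangle> \<ge> d\<^sup>2(z,p) - d(z,p) d(u,q)\<close>, with the inner product written in terms of distances.
\<close>
lemma nearest_point_gradient:
  fixes z u :: "'a::CAT0_space"
  assumes C: "geodesically_convex C" and p: "nearest_point C z p" and q: "q \<in> C"
  shows "(dist u p)\<^sup>2 \<le> (dist z u)\<^sup>2 - (dist z p)\<^sup>2 + 2 * dist z p * dist u q"
  using nearest_point_pythagoras[OF C p q] CAT0_quadrilateral[of p u q z]
  by (simp add: dist_commute)

lemma nearest_point_between_best_pair:
  assumes "x \<in> A" "y \<in> B" and m: "dist m x + dist m y \<le> setdist A B"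
  shows "nearest_point A m x"
  unfolding nearest_point_def
proof (intro conjI ballI)
  fix w assume "w \<in> A"
  then have "setdist A B \<le> dist w y"
    using \<open>y \<in> B\<close> by (rule setdist_le_dist)
  then show "dist m x \<le> dist m w"
    using m dist_triangle[of w y m] by (simp add: dist_commute)
qed fact

lemma nearest_point_metric_proj:
  "metric_proj_defined C \<Longrightarrow> nearest_point C x (metric_proj C x)"
  unfolding metric_proj_defined_def metric_proj_def by (blast intro: theI')

section \<open>One step of the averaged projection method\<close>

text \<open>
  The point \<open>geodesic_point t a b\<close> is the image of \<open>z\<close> under the averaged projection. Its distance
  to \<open>u\<close> is estimated by the CAT(0) inequality, and the distances from \<open>u\<close> to \<open>a\<close> and \<open>b\<close> by the
  gradient inequalities for the two sets.
\<close>
lemma averaged_projection_step: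
  fixes z u :: "'a::CAT0_space"
  assumes A: "geodesically_convex A" "nearest_point A z a" "x \<in> A"
    and B: "geodesically_convex B" "nearest_point B z b" "y \<in> B"
    and t: "0 \<le> t" "t \<le> 1"
    and ux: "dist u x = t * r" and uy: "dist u y = (1 - t) * r"
  shows "(dist (geodesic_point t a b) u)\<^sup>2 + t * (1 - t) * (dist a b)\<^sup>2
      + ((1 - t) * (dist z a)\<^sup>2 + t * (dist z b)\<^sup>2)
    \<le> (dist z u)\<^sup>2 + 2 * t * (1 - t) * r * (dist z a + dist z b)"
proof -
  have "(dist (geodesic_point t a b) u)\<^sup>2 + t * (1 - t) * (dist a b)\<^sup>2
      \<le> (1 - t) * (dist u a)\<^sup>2 + t * (dist u b)\<^sup>2"
    using geodesic_point_CAT0[OF t, of u a b] by (simp add: dist_commute)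
  also have "\<dots> \<le> (1 - t) * ((dist z u)\<^sup>2 - (dist z a)\<^sup>2 + 2 * dist z a * (t * r))
      + t * ((dist z u)\<^sup>2 - (dist z b)\<^sup>2 + 2 * dist z b * ((1 - t) * r))"
    using t nearest_point_gradient[OF A, of u] nearest_point_gradient[OF B, of u]
    unfolding ux uy by (intro add_mono mult_left_mono) auto
  finally show ?thesis
    by (simp add: algebra_simps)
qed

text \<open>
  The sum \<open>d(z,a) + d(z,b)\<close> can be replaced by \<open>d(a,b)\<close>, which it dominates, since
  \<open>s \<mapsto> s(s - r)\<close> increases for \<open>s \<ge> r\<close>. The value of \<open>f\<close> at \<open>z\<close> is kept on the right: for an
  iterate it is bounded by the term \<open>t(1 - t) d\<^sup>2(a,b)\<close> of the step before, and this makes the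
  estimates telescope.
\<close>
lemma averaged_projection_energy:
  fixes z u :: "'a::CAT0_space"
  assumes A: "geodesically_convex A" "nearest_point A z a" "x \<in> A"
    and B: "geodesically_convex B" "nearest_point B z b" "y \<in> B"
    and t: "0 \<le> t" "t \<le> 1"
    and ux: "dist u x = t * r" and uy: "dist u y = (1 - t) * r"
    and r: "r \<le> dist a b"
  shows "(dist (geodesic_point t a b) u)\<^sup>2 + t * (1 - t) * (dist a b)\<^sup>2
      + 2 * (t * (1 - t)) * (dist a b * (dist a b - r))
    \<le> (dist z u)\<^sup>2 + ((1 - t) * (dist z a)\<^sup>2 + t * (dist z b)\<^sup>2)"
proof -
  define s where "s = dist z a + dist z b"
  have s: "dist a b \<le> s"
    unfolding s_def using dist_triangle[of a b z] by (simp add: dist_commute)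
  have "dist a b * (dist a b - r) \<le> s * (s - r)"
    using s r order_trans[OF zero_le_dist s] by (intro mult_mono) auto
  then have "t * (1 - t) * (dist a b * (dist a b - r)) \<le> t * (1 - t) * (s * (s - r))"
    using t by (intro mult_left_mono) auto
  moreover have "t * (1 - t) * s\<^sup>2 \<le> (1 - t) * (dist z a)\<^sup>2 + t * (dist z b)\<^sup>2"
    using weighted_square_sum_ge[of t "dist z b" "dist z a"] by (simp add: s_def add.commute)
  moreover have "t * (1 - t) * (s * (s - r)) = t * (1 - t) * s\<^sup>2 - t * (1 - t) * r * s"
    by (simp add: power2_eq_square algebra_simps)
  moreover note averaged_projection_step[OF A B t ux uy, folded s_def]
  ultimately show ?thesis
    by (simp add: mult.assoc)
qed

text \<open>
  No predecessor of \<open>z\<close> is available at the start of the iteration; there the average is simply no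
  farther from \<open>u\<close> than \<open>z\<close> is, by completing a square in \<open>averaged_projection_step\<close>.
\<close>
lemma averaged_projection_fejer:
  fixes z u :: "'a::CAT0_space"
  assumes A: "geodesically_convex A" "nearest_point A z a" "x \<in> A"
    and B: "geodesically_convex B" "nearest_point B z b" "y \<in> B"
    and t: "0 \<le> t" "t \<le> 1"
    and ux: "dist u x = t * r" and uy: "dist u y = (1 - t) * r"
    and r: "0 \<le> r" "r \<le> dist a b"
  shows "dist (geodesic_point t a b) u \<le> dist z u"
proof -
  define s where "s = dist z a + dist z b"
  have "r\<^sup>2 \<le> (dist a b)\<^sup>2"
    using r by (intro power_mono)
  then have "0 \<le> (s - r)\<^sup>2 + ((dist a b)\<^sup>2 - r\<^sup>2)"
    by simp
  then have "0 \<le> t * (1 - t) * ((s - r)\<^sup>2 + ((dist a b)\<^sup>2 - r\<^sup>2))"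
    using t by (intro mult_nonneg_nonneg) auto
  also have "\<dots> = t * (1 - t) * s\<^sup>2 + t * (1 - t) * (dist a b)\<^sup>2 - 2 * t * (1 - t) * r * s"
    by (simp add: power2_eq_square algebra_simps)
  finally have "2 * t * (1 - t) * r * s \<le> t * (1 - t) * s\<^sup>2 + t * (1 - t) * (dist a b)\<^sup>2"
    by simp
  moreover have "t * (1 - t) * s\<^sup>2 \<le> (1 - t) * (dist z a)\<^sup>2 + t * (dist z b)\<^sup>2"
    using weighted_square_sum_ge[of t "dist z b" "dist z a"] by (simp add: s_def add.commute)
  moreover note averaged_projection_step[OF A B t ux uy, folded s_def]
  ultimately have "(dist (geodesic_point t a b) u)\<^sup>2 \<le> (dist z u)\<^sup>2"
    by linarith
  then show ?thesis
    by (rule power2_le_imp_le) simp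
qed

section \<open>The rate of convergence\<close>

theorem corollary3p3:
  fixes A B :: "'a::CAT0_space set"
    and T :: "'a \<Rightarrow> 'a"
    and x xs ys us :: 'a
    and lam r M b \<epsilon> :: real
    and n :: nat
  assumes "geodesically_convex A" "closed A" "A \<noteq> {}"
    and "geodesically_convex B" "closed B" "B \<noteq> {}"
    and "metric_proj_defined A" "metric_proj_defined B"
    and "0 < lam" "lam < 1"
    and T: "\<And>z. T z = geodesic_point lam (metric_proj A z) (metric_proj B z)"
    and r: "r = setdist A B"
    and "(xs, ys) \<in> best_approx_pairs A B"
    and "M > 0" "b > 0"
    and us: "us = geodesic_point lam xs ys"
    and "dist x us \<le> M"
    and "(dist (metric_proj A x) (metric_proj B x))\<^sup>2 \<le> b"
    and "\<epsilon> > 0"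
    and "int n \<ge> \<lfloor>64 * M\<^sup>2 * b / (\<epsilon> ^ 4 * lam * (1 - lam))\<rfloor> + 2"
  shows "dist (metric_proj A ((T ^^ n) x)) (metric_proj B ((T ^^ n) x)) \<le> r + \<epsilon>"
proof (rule ccontr)
  assume far: "\<not> ?thesis"
  define L where "L = lam * (1 - lam)"
  define X where "X k = (T ^^ k) x" for k
  define a where "a k = metric_proj A (X k)" for k
  define c where "c k = metric_proj B (X k)" for k
  define D where "D k = dist (a k) (c k)" for k
  have lam: "0 \<le> lam" "lam \<le> 1"
    using assms by auto
  have L: "0 < L" "L \<le> 1 / 4"
    using assms zero_le_power2[of "lam - 1/2"] by (auto simp: L_def power2_eq_square algebra_simps)
  have XSuc: "X (Suc k) = geodesic_point lam (a k) (c k)" for k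
    by (simp add: X_def a_def c_def T)
  have cA: "geodesically_convex A" and nA: "nearest_point A (X k) (a k)"
    and cB: "geodesically_convex B" and nB: "nearest_point B (X k) (c k)" for k
    using assms nearest_point_metric_proj by (auto simp: a_def c_def)
  have in_A: "a k \<in> A" and in_B: "c k \<in> B" for k
    using nA nB by (auto simp: nearest_point_def)
  have pair: "xs \<in> A" "ys \<in> B" "dist xs ys = r"
    using assms by (auto simp: best_approx_pairs_def)
  have ux: "dist us xs = lam * r" and uy: "dist us ys = (1 - lam) * r"
    using geodesic_point_dist[OF lam, of xs ys] pair by (auto simp: us)
  have r0: "0 \<le> r" and rD: "r \<le> D k" for k
    unfolding r D_def using setdist_le_dist[OF in_A in_B] by auto

  have Xa: "dist (X (Suc k)) (a (Suc k)) \<le> lam * D k"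
    and Xc: "dist (X (Suc k)) (c (Suc k)) \<le> (1 - lam) * D k" for k
  proof -
    show "dist (X (Suc k)) (a (Suc k)) \<le> lam * D k"
      using nA[of "Suc k"] in_A[of k] geodesic_point_dist(1)[OF lam, of "a k" "c k"]
      by (auto simp: nearest_point_def XSuc D_def)
    show "dist (X (Suc k)) (c (Suc k)) \<le> (1 - lam) * D k"
      using nB[of "Suc k"] in_B[of k] geodesic_point_dist(2)[OF lam, of "a k" "c k"]
      by (auto simp: nearest_point_def XSuc D_def)
  qed
  have "D (Suc k) \<le> D k" for k
  proof -
    have "D (Suc k) \<le> dist (X (Suc k)) (a (Suc k)) + dist (X (Suc k)) (c (Suc k))"
      unfolding D_def by (metis dist_commute dist_triangle)
    then show ?thesis
      using Xa[of k] Xc[of k] by (simp add: algebra_simps)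
  qed
  then have "decseq D"
    by (rule decseq_SucI)
  then have D_far: "r + \<epsilon> < D k" if "k \<le> n" for k
    using decseqD[of D k n] that far by (simp add: D_def a_def c_def X_def)

  \<comment> \<open>The index of \<open>D\<close> lags behind that of \<open>X\<close>, since \<open>L * (D k)\<^sup>2\<close> bounds the weighted squared
    distances from \<open>X (Suc k)\<close> to the two sets.\<close>
  define E where "E k = (dist (X (Suc k)) us)\<^sup>2 + L * (D k)\<^sup>2" for k
  have step: "E (Suc k) + 2 * L * (D (Suc k) * (D (Suc k) - r)) \<le> E k" for k
  proof -
    have "(1 - lam) * (dist (X (Suc k)) (a (Suc k)))\<^sup>2 + lam * (dist (X (Suc k)) (c (Suc k)))\<^sup>2
        \<le> (1 - lam) * (lam * D k)\<^sup>2 + lam * ((1 - lam) * D k)\<^sup>2"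
      using lam Xa[of k] Xc[of k] by (intro add_mono mult_left_mono power_mono) auto
    also have "\<dots> = L * (D k)\<^sup>2"
      by (simp add: L_def power2_eq_square algebra_simps)
    finally show ?thesis
      using averaged_projection_energy[OF cA nA[of "Suc k"] pair(1) cB nB[of "Suc k"] pair(2) lam ux uy
          rD[of "Suc k", unfolded D_def]]
      by (simp add: E_def XSuc[of "Suc k"] L_def D_def)
  qed
  have telescope: "E k + k * (2 * L * \<epsilon>\<^sup>2) \<le> E 0" if "k \<le> n" for k
    using that
  proof (induction k)
    case (Suc k)
    have "\<epsilon> * \<epsilon> \<le> D (Suc k) * (D (Suc k) - r)"
      using D_far[OF Suc.prems] \<open>\<epsilon> > 0\<close> r0 by (intro mult_mono) auto
    then have "2 * L * \<epsilon>\<^sup>2 \<le> 2 * L * (D (Suc k) * (D (Suc k) - r))"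
      using L by (simp add: power2_eq_square)
    then show ?case
      using step[of k] Suc by (simp add: algebra_simps)
  qed simp

  have "dist (X 1) us \<le> dist (X 0) us"
    using averaged_projection_fejer[OF cA nA[of 0] pair(1) cB nB[of 0] pair(2) lam ux uy r0
        rD[of 0, unfolded D_def]]
    by (simp add: XSuc)
  then have "(dist (X 1) us)\<^sup>2 \<le> M\<^sup>2"
    using \<open>dist x us \<le> M\<close> by (intro power_mono) (auto simp: X_def)
  moreover have D0b: "(D 0)\<^sup>2 \<le> b"
    using assms by (simp add: D_def a_def c_def X_def)
  ultimately have "E 0 \<le> M\<^sup>2 + L * b"
    unfolding E_def using L by (intro add_mono mult_left_mono) auto
  moreover have "0 \<le> E n"
    using L by (simp add: E_def)
  ultimately have count: "n * (2 * L * \<epsilon>\<^sup>2) \<le> M\<^sup>2 + L * b"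
    using telescope[of n] by simp

  have "\<epsilon>\<^sup>2 \<le> (D 0)\<^sup>2"
    using D_far[of 0] r0 \<open>\<epsilon> > 0\<close> by (intro power_mono) auto
  with D0b have eps_b: "\<epsilon>\<^sup>2 \<le> b"
    by simp
  have eps_M: "\<epsilon>\<^sup>2 \<le> 4 * M\<^sup>2"
  proof -
    have "dist us xs + dist us ys = setdist A B"
      unfolding ux uy r[symmetric] by (simp add: algebra_simps)
    then have "nearest_point A us xs" "nearest_point B us ys"
      using pair nearest_point_between_best_pair[of xs A ys B us]
        nearest_point_between_best_pair[of ys B xs A us]
      by (simp_all add: setdist_sym[of B A] add.commute)
    then have "dist (a 0) xs \<le> M" "dist (c 0) ys \<le> M"
      using nearest_point_nonexpansive[OF cA nA[of 0], of us xs]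
        nearest_point_nonexpansive[OF cB nB[of 0], of us ys] \<open>dist x us \<le> M\<close>
      by (simp_all add: X_def)
    moreover have "D 0 \<le> dist (a 0) xs + dist xs ys + dist (c 0) ys"
      unfolding D_def
      using dist_triangle[of "a 0" "c 0" xs] dist_triangle[of xs "c 0" ys]
      by (simp add: dist_commute)
    ultimately have "\<epsilon> \<le> 2 * M"
      using D_far[of 0] pair(3) by simp
    then have "\<epsilon>\<^sup>2 \<le> (2 * M)\<^sup>2"
      using \<open>\<epsilon> > 0\<close> by (intro power_mono) auto
    then show ?thesis
      by (simp add: power_mult_distrib)
  qed

  have "real n * (\<epsilon> ^ 4 * L) * 2 = n * (2 * L * \<epsilon>\<^sup>2) * \<epsilon>\<^sup>2"
    by (simp add: power2_eq_square power4_eq_xxxx)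
  also have "\<dots> \<le> (M\<^sup>2 + L * b) * \<epsilon>\<^sup>2"
    using count by (intro mult_right_mono) auto
  also have "\<dots> = M\<^sup>2 * \<epsilon>\<^sup>2 + L * (b * \<epsilon>\<^sup>2)"
    by (simp add: algebra_simps)
  also have "\<dots> \<le> M\<^sup>2 * b + 1 / 4 * (b * (4 * M\<^sup>2))"
    using eps_b eps_M L \<open>b > 0\<close> by (intro add_mono mult_mono mult_left_mono) auto
  finally have "real n * (\<epsilon> ^ 4 * L) \<le> M\<^sup>2 * b"
    by (simp add: mult.commute)
  also have "\<dots> \<le> 64 * M\<^sup>2 * b"
    using \<open>b > 0\<close> by simp
  finally have "real n \<le> 64 * M\<^sup>2 * b / (\<epsilon> ^ 4 * L)"
    using L \<open>\<epsilon> > 0\<close> by (simp add: pos_le_divide_eq)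
  then have "int n \<le> \<lfloor>64 * M\<^sup>2 * b / (\<epsilon> ^ 4 * lam * (1 - lam))\<rfloor>"
    by (simp add: L_def le_floor_iff mult.assoc)
  then show False
    using \<open>int n \<ge> \<lfloor>64 * M\<^sup>2 * b / (\<epsilon> ^ 4 * lam * (1 - lam))\<rfloor> + 2\<close> by linarith
qed

end
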